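(* (Extension) Let $N\ge1$, $I\in\mathbb{S}$, and let $\Omega_I$ be a domain in $\mathbb{C}_I$, symmetric with respect to the real axis and such that $\Omega_I\cap\mathbb{R}\neq\emptyset$. Let $\Omega$ be the axially symmetric completion of $\Omega_I$ in $\mathbb{H}$. If $$f(z)=\sum_{k=0}^{N-1}\overline{z}^{\,k}h_k(z),\qquad z\in\Omega_I,$$ where $h_k:\Omega_I\to\mathbb{H}$ are holomorphic functions such that $\overline{h_k(\overline z)}=h_k(z)$ for all $z\in\Omega_I$, then the unique slice polyanalytic extension (of order $N$) of $f$ to $\Omega$ is $$\mathrm{ext}(f)(q):=\sum_{k=0}^{N-1}\overline{q}^{\,k}\,\mathrm{ext}(h_k)(q),\qquad q=x+I_qy\in\Omega.$$
   Context: $\mathbb{H}$ denotes the quaternions, $\mathbb{S}=\{q\in\mathbb{H}: q^2=-1\}$, and for $I\in\mathbb{S}$, $\mathbb{C}_I=\mathbb{R}+\mathbb{R}I$. An open set $\Omega$ is axially symmetric if $x+Iy\in\Omega$ implies $x+Jy\in\Omega$ for all $J\in\mathbb{S}$. The axially symmetric completion of $\Omega_I\subset\mathbb{C}_I$ is $\{x+Jy: J\in\mathbb{S},\ x+Iy\in\Omega_I\}$. A function $h:\Omega_I\to\mathbb{H}$ is holomorphic if $\frac12(\partial_x+I\partial_y)h(x+Iy)=0$ on $\Omega_I$. For such $h$, its slice regular extension to the axially symmetric completion is $$\mathrm{ext}(h)(x+Jy)=\tfrac12[h(x+Iy)+h(x-Iy)]+\tfrac{JI}{2}[h(x-Iy)-h(x+Iy)],\quad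 J\in\mathbb{S}.$$ Bars denote quaternionic conjugation. Slice polyanalytic functions: let $\Omega$ be an axially symmetric open set and $\mathcal{U}=\{(x,y)\in\mathbb{R}^2: x+Iy\in\Omega \text{ for all } I\in\mathbb{S}\}$. A function $f:\Omega\to\mathbb{H}$ is a (left) slice function if $f(x+Iy)=\alpha(x,y)+I\beta(x,y)$ for all $x+Iy\in\Omega$, $I\in\mathbb{S}$, where $\alpha,\beta:\mathcal{U}\to\mathbb{H}$ do not depend on $I$ and satisfy $\alpha(x,-y)=\alpha(x,y)$, $\beta(x,-y)=-\beta(x,y)$. If moreover $\alpha,\beta$ are of class $\mathcal{C}^N$ and $\frac{1}{2^N}(\partial_x+I\partial_y)^N(\alpha(x,y)+I\beta(x,y))=0$ for all $I\in\mathbb{S}$, then $f$ is called (left) slice polyanalytic of order $N$. *)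

theory Defs
  imports "HOL-Analysis.Analysis"
begin

codatatype quat = Quat (qRe: real) (qI: real) (qJ: real) (qK: real)

lemma quat_eqI [intro?]:
  "\<lbrakk>qRe p = qRe q; qI p = qI q; qJ p = qJ q; qK p = qK q\<rbrakk> \<Longrightarrow> p = q"
  by (rule quat.expand) simp

lemma quat_eq_iff: "p = q \<longleftrightarrow> qRe p = qRe q \<and> qI p = qI q \<and> qJ p = qJ q \<and> qK p = qK q"
  by (auto intro: quat_eqI)

instantiation quat :: ab_group_add
begin

definition "0 = Quat 0 0 0 0"

definition "p + q = Quat (qRe p + qRe q) (qI p + qI q) (qJ p + qJ q) (qK p + qK q)"

definition "- p = Quat (- qRe p) (- qI p) (- qJ p) (- qK p)" for p :: quat

definition "p - q = Quat (qRe p - qRe q) (qI p - qI q) (qJ p - qJ q) (qK p - qK q)"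

instance
  by standard
    (auto simp: quat_eq_iff zero_quat_def plus_quat_def uminus_quat_def minus_quat_def)

end

lemma quat_zero_sel [simp]: "qRe 0 = 0" "qI 0 = 0" "qJ 0 = 0" "qK 0 = 0"
  by (simp_all add: zero_quat_def)

lemma quat_add_sel [simp]:
  "qRe (p + q) = qRe p + qRe q" "qI (p + q) = qI p + qI q"
  "qJ (p + q) = qJ p + qJ q" "qK (p + q) = qK p + qK q"
  by (simp_all add: plus_quat_def)

lemma quat_uminus_sel [simp]:
  "qRe (- p) = - qRe p" "qI (- p) = - qI p" "qJ (- p) = - qJ p" "qK (- p) = - qK p"
  by (simp_all add: uminus_quat_def)

lemma quat_diff_sel [simp]:
  "qRe (p - q) = qRe p - qRe q" "qI (p - q) = qI p - qI q"
  "qJ (p - q) = qJ p - qJ q" "qK (p - q) = qK p - qK q"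
  by (simp_all add: minus_quat_def)

instantiation quat :: ring_1
begin

definition "1 = Quat 1 0 0 0"

definition "p * q = Quat
  (qRe p * qRe q - qI p * qI q - qJ p * qJ q - qK p * qK q)
  (qRe p * qI q + qI p * qRe q + qJ p * qK q - qK p * qJ q)
  (qRe p * qJ q - qI p * qK q + qJ p * qRe q + qK p * qI q)
  (qRe p * qK q + qI p * qJ q - qJ p * qI q + qK p * qRe q)"

instance
  by standard (auto simp: quat_eq_iff one_quat_def times_quat_def algebra_simps)

end

lemma quat_one_sel [simp]: "qRe 1 = 1" "qI 1 = 0" "qJ 1 = 0" "qK 1 = 0"
  by (simp_all add: one_quat_def)

lemma quat_mult_sel [simp]:
  "qRe (p * q) = qRe p * qRe q - qI p * qI q - qJ p * qJ q - qK p * qK q"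
  "qI (p * q) = qRe p * qI q + qI p * qRe q + qJ p * qK q - qK p * qJ q"
  "qJ (p * q) = qRe p * qJ q - qI p * qK q + qJ p * qRe q + qK p * qI q"
  "qK (p * q) = qRe p * qK q + qI p * qJ q - qJ p * qI q + qK p * qRe q"
  by (simp_all add: times_quat_def)

instantiation quat :: real_algebra_1
begin

definition "r *\<^sub>R q = Quat (r * qRe q) (r * qI q) (r * qJ q) (r * qK q)"

instance
  by standard (auto simp: quat_eq_iff scaleR_quat_def algebra_simps)

end

lemma quat_scaleR_sel [simp]:
  "qRe (r *\<^sub>R q) = r * qRe q" "qI (r *\<^sub>R q) = r * qI q"
  "qJ (r *\<^sub>R q) = r * qJ q" "qK (r *\<^sub>R q) = r * qK q"
  by (simp_all add: scaleR_quat_def)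

lemma quat_of_real_sel [simp]:
  "qRe (of_real r) = r" "qI (of_real r) = 0" "qJ (of_real r) = 0" "qK (of_real r) = 0"
  by (simp_all add: of_real_def)

definition qcnj :: "quat \<Rightarrow> quat"
  where "qcnj q = Quat (qRe q) (- qI q) (- qJ q) (- qK q)"

lemma qcnj_sel [simp]:
  "qRe (qcnj q) = qRe q" "qI (qcnj q) = - qI q" "qJ (qcnj q) = - qJ q" "qK (qcnj q) = - qK q"
  by (simp_all add: qcnj_def)

instantiation quat :: real_inner
begin

definition "inner p q = qRe p * qRe q + qI p * qI q + qJ p * qJ q + qK p * qK q"

definition "norm q = sqrt ((qRe q)\<^sup>2 + (qI q)\<^sup>2 + (qJ q)\<^sup>2 + (qK q)\<^sup>2)"

definition "sgn q = q /\<^sub>R norm q" for q :: quat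

definition "dist p q = norm (p - q)" for p q :: quat

definition uniformity_quat_def [code del]:
  "(uniformity :: (quat \<times> quat) filter) = (INF e\<in>{0 <..}. principal {(x, y). dist x y < e})"

definition open_quat_def [code del]:
  "open (U :: quat set) \<longleftrightarrow> (\<forall>x\<in>U. eventually (\<lambda>(x', y). x' = x \<longrightarrow> y \<in> U) uniformity)"

instance
proof
  fix x y z :: quat and r :: real
  show "inner x y = inner y x"
    by (simp add: inner_quat_def mult.commute)
  show "inner (x + y) z = inner x z + inner y z" "inner (r *\<^sub>R x) y = r * inner x y"
    by (simp_all add: inner_quat_def distrib_right distrib_left)
  show "0 \<le> inner x x"
    by (simp add: inner_quat_def)
  show "inner x x = 0 \<longleftrightarrow> x = 0"
    by (simp add: inner_quat_def add_nonneg_eq_0_iff quat_eq_iff)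
  show "norm x = sqrt (inner x x)"
    by (simp add: inner_quat_def norm_quat_def power2_eq_square)
qed (rule sgn_quat_def dist_quat_def uniformity_quat_def open_quat_def)+

end

instantiation quat :: real_normed_div_algebra
begin

definition "inverse q = qcnj q /\<^sub>R (norm q)\<^sup>2" for q :: quat

definition "p div q = p * inverse q" for p q :: quat

instance
proof
  have norm2: "(norm q)\<^sup>2 = (qRe q)\<^sup>2 + (qI q)\<^sup>2 + (qJ q)\<^sup>2 + (qK q)\<^sup>2" for q :: quat
    by (simp add: norm_quat_def)
  fix p q :: quat
  show "norm (p * q) = norm p * norm q"
    unfolding norm_quat_def real_sqrt_mult [symmetric]
    by (rule arg_cong [where f = sqrt], simp only: quat_mult_sel, algebra)
  have *: "q * qcnj q = of_real ((norm q)\<^sup>2)" "qcnj q * q = of_real ((norm q)\<^sup>2)"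
    unfolding norm2 by (simp_all add: quat_eq_iff power2_eq_square)
  show "inverse q * q = 1" "q * inverse q = 1" if "q \<noteq> 0"
    using that by (simp_all add: inverse_quat_def * del: of_real_power) (simp_all add: of_real_def)
  show "inverse (0 :: quat) = 0"
    by (simp add: inverse_quat_def quat_eq_iff)
qed (rule divide_quat_def)

end

definition quat_sphere :: "quat set" where
  "quat_sphere = {q. q\<^sup>2 = - 1}"

definition slice_point :: "quat \<Rightarrow> real \<Rightarrow> real \<Rightarrow> quat" where
  "slice_point I x y = of_real x + I * of_real y"

definition slice_plane :: "quat \<Rightarrow> quat set" where
  "slice_plane I = {slice_point I x y | x y. True}"

definition axially_symmetric :: "quat set \<Rightarrow> bool" where
  "axially_symmetric \<Omega> \<longleftrightarrow>
     (\<forall>I\<in>quat_sphere. \<forall>x y. slice_point I x y \<in> \<Omega> \<longrightarrow>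
        (\<forall>J\<in>quat_sphere. slice_point J x y \<in> \<Omega>))"

definition axial_completion :: "quat \<Rightarrow> quat set \<Rightarrow> quat set" where
  "axial_completion I D =
     {slice_point J x y | J x y. J \<in> quat_sphere \<and> slice_point I x y \<in> D}"

definition partial_x :: "(real \<times> real \<Rightarrow> quat) \<Rightarrow> real \<times> real \<Rightarrow> quat" where
  "partial_x g = (\<lambda>(x, y). vector_derivative (\<lambda>t. g (t, y)) (at x))"

definition partial_y :: "(real \<times> real \<Rightarrow> quat) \<Rightarrow> real \<times> real \<Rightarrow> quat" where
  "partial_y g = (\<lambda>(x, y). vector_derivative (\<lambda>t. g (x, t)) (at y))"

definition cr_op :: "quat \<Rightarrow> (real \<times> real \<Rightarrow> quat) \<Rightarrow> real \<times> real \<Rightarrow> quat" where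
  "cr_op I g = (\<lambda>p. partial_x g p + I * partial_y g p)"

text \<open>
  Real differentiability is part of the definition of holomorphy: the mere existence of
  the partial derivatives occurring in the Cauchy--Riemann equation would not be enough.
\<close>

definition slice_holomorphic_on :: "quat \<Rightarrow> quat set \<Rightarrow> (quat \<Rightarrow> quat) \<Rightarrow> bool" where
  "slice_holomorphic_on I D h \<longleftrightarrow>
     (let g = (\<lambda>(x, y). h (slice_point I x y)) in
       \<forall>x y. slice_point I x y \<in> D \<longrightarrow>
         g differentiable (at (x, y)) \<and> (1 / 2) *\<^sub>R cr_op I g (x, y) = 0)"

text \<open>
  The unit \<open>I\<^sub>q\<close> of a non-real quaternion \<open>q\<close>.  For real \<open>q\<close> every unit is admissible and we
  fix an arbitrary one.  Every \<open>q\<close> is then \<open>x + I\<^sub>q y\<close> with \<open>x\<close> its real part and \<open>y \<ge> 0\<close> the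
  norm of its imaginary part.
\<close>

definition qIm :: "quat \<Rightarrow> quat" where
  "qIm q = Quat 0 (qI q) (qJ q) (qK q)"

definition im_unit :: "quat \<Rightarrow> quat" where
  "im_unit q = (if qIm q = 0 then Quat 0 1 0 0 else qIm q /\<^sub>R norm (qIm q))"

definition slice_ext :: "quat \<Rightarrow> (quat \<Rightarrow> quat) \<Rightarrow> quat \<Rightarrow> quat" where
  "slice_ext I h q =
     (let x = qRe q; y = norm (qIm q); J = im_unit q in
       (1 / 2) *\<^sub>R (h (slice_point I x y) + h (slice_point I x (- y))) +
       (1 / 2) *\<^sub>R (J * I) * (h (slice_point I x (- y)) - h (slice_point I x y)))"

lemma quat_sphere_iff:
  "J \<in> quat_sphere \<longleftrightarrow> qRe J = 0 \<and> (qI J)\<^sup>2 + (qJ J)\<^sup>2 + (qK J)\<^sup>2 = 1"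
proof
  assume "J \<in> quat_sphere"
  then have eqs: "qRe J * qRe J - qI J * qI J - qJ J * qJ J - qK J * qK J = -1"
    "qRe J * qI J = 0" "qRe J * qJ J = 0" "qRe J * qK J = 0"
    by (auto simp: quat_sphere_def power2_eq_square quat_eq_iff)
  have "qRe J = 0"
  proof (rule ccontr)
    assume "qRe J \<noteq> 0"
    with eqs have "qRe J * qRe J = - 1" by simp
    then show False using zero_le_square [of "qRe J"] by linarith
  qed
  with eqs show "qRe J = 0 \<and> (qI J)\<^sup>2 + (qJ J)\<^sup>2 + (qK J)\<^sup>2 = 1"
    by (simp add: power2_eq_square)
next
  assume "qRe J = 0 \<and> (qI J)\<^sup>2 + (qJ J)\<^sup>2 + (qK J)\<^sup>2 = 1"
  then show "J \<in> quat_sphere"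
    by (simp add: quat_sphere_def power2_eq_square quat_eq_iff)
qed

lemma im_unit_in_sphere: "im_unit q \<in> quat_sphere"
proof (cases "qIm q = 0")
  case False
  define n where "n = norm (qIm q)"
  have n: "n\<^sup>2 = (qI q)\<^sup>2 + (qJ q)\<^sup>2 + (qK q)\<^sup>2"
    by (simp add: n_def norm_quat_def qIm_def)
  have "n \<noteq> 0"
    using False by (simp add: n_def)
  have "(qI q / n)\<^sup>2 + (qJ q / n)\<^sup>2 + (qK q / n)\<^sup>2 = 1"
    unfolding power_divide add_divide_distrib [symmetric] n [symmetric]
    using \<open>n \<noteq> 0\<close> by simp
  with False show ?thesis
    by (simp add: quat_sphere_iff im_unit_def flip: n_def) (simp add: qIm_def divide_inverse mult.commute)
qed (simp add: quat_sphere_iff im_unit_def)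

lemma slice_point_im_unit: "slice_point (im_unit q) (qRe q) (norm (qIm q)) = q"
  by (cases "qIm q = 0") (auto simp: slice_point_def im_unit_def qIm_def quat_eq_iff)

text \<open>The extension does not depend on how \<open>q\<close> is written as \<open>x + J y\<close>.\<close>

lemma slice_ext_slice_point:
  assumes "J \<in> quat_sphere"
  shows "slice_ext I h (slice_point J x y) =
    (1 / 2) *\<^sub>R (h (slice_point I x y) + h (slice_point I x (- y))) +
    (1 / 2) *\<^sub>R (J * I) * (h (slice_point I x (- y)) - h (slice_point I x y))"
proof -
  let ?q = "slice_point J x y"
  have J: "qRe J = 0" "(qI J)\<^sup>2 + (qJ J)\<^sup>2 + (qK J)\<^sup>2 = 1"
    using assms by (simp_all add: quat_sphere_iff)
  have re: "qRe ?q = x" using J by (simp add: slice_point_def)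
  have im: "qIm ?q = y *\<^sub>R J"
    using J by (simp add: slice_point_def qIm_def quat_eq_iff)
  have nJ: "norm J = 1" using J by (simp add: norm_quat_def)
  then have J0: "J \<noteq> 0" by auto
  consider "y = 0" | "y > 0" | "y < 0" by linarith
  then show ?thesis
  proof cases
    case 1
    then show ?thesis using im re by (simp add: slice_ext_def)
  next
    case 2
    then have "im_unit ?q = J" using J0 nJ by (simp add: im_unit_def im)
    with 2 show ?thesis by (simp add: slice_ext_def re im nJ)
  next
    case 3
    then have "im_unit ?q = - J"
      using J0 nJ by (simp add: im_unit_def im scaleR_minus_left [symmetric] del: scaleR_minus_left)
    moreover have "- (c *\<^sub>R (J * I) * (a - b)) = c *\<^sub>R (J * I) * (b - a)" for a b c
      by (simp add: right_diff_distrib)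
    ultimately show ?thesis using 3
      by (simp add: slice_ext_def Let_def re im nJ)
  qed
qed

definition poly_ext :: "nat \<Rightarrow> quat \<Rightarrow> (nat \<Rightarrow> quat \<Rightarrow> quat) \<Rightarrow> quat \<Rightarrow> quat" where
  "poly_ext N I h q = (\<Sum>k<N. qcnj q ^ k * slice_ext I (h k) q)"

text \<open>
  Class \<open>C\<^sup>n\<close> on an open subset of a Euclidean space; differentiating along all
  directions \<open>v\<close> covers the partial derivatives of all orders up to \<open>n\<close>.
\<close>

fun C_class_on ::
  "nat \<Rightarrow> 'a::real_normed_vector set \<Rightarrow> ('a \<Rightarrow> 'b::real_normed_vector) \<Rightarrow> bool" where
  "C_class_on 0 S g \<longleftrightarrow> continuous_on S g"
| "C_class_on (Suc n) S g \<longleftrightarrow>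
     (\<forall>x\<in>S. g differentiable (at x)) \<and>
     (\<forall>v. C_class_on n S (\<lambda>x. frechet_derivative g (at x) v))"

text \<open>
  Below, \<open>\<alpha>\<close> and \<open>\<beta>\<close> are total functions of which only the restriction to \<open>slice_base \<Omega>\<close>
  matters: \<open>\<Omega>\<close> is required to be open and axially symmetric, so \<open>slice_base \<Omega>\<close> is open and
  iterated partial derivatives at its points are determined by the values on it.
\<close>

definition slice_base :: "quat set \<Rightarrow> (real \<times> real) set" where
  "slice_base \<Omega> = {(x, y). \<forall>I\<in>quat_sphere. slice_point I x y \<in> \<Omega>}"

definition slice_components ::
  "quat set \<Rightarrow> (quat \<Rightarrow> quat) \<Rightarrow> (real \<times> real \<Rightarrow> quat) \<Rightarrow> (real \<times> real \<Rightarrow> quat) \<Rightarrow> bool" where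
  "slice_components \<Omega> f \<alpha> \<beta> \<longleftrightarrow>
     (\<forall>I\<in>quat_sphere. \<forall>x y. slice_point I x y \<in> \<Omega> \<longrightarrow>
        f (slice_point I x y) = \<alpha> (x, y) + I * \<beta> (x, y)) \<and>
     (\<forall>(x, y)\<in>slice_base \<Omega>. \<alpha> (x, - y) = \<alpha> (x, y) \<and> \<beta> (x, - y) = - \<beta> (x, y))"

definition slice_polyanalytic_on :: "nat \<Rightarrow> quat set \<Rightarrow> (quat \<Rightarrow> quat) \<Rightarrow> bool" where
  "slice_polyanalytic_on N \<Omega> f \<longleftrightarrow>
     open \<Omega> \<and> axially_symmetric \<Omega> \<and>
     (\<exists>\<alpha> \<beta>. slice_components \<Omega> f \<alpha> \<beta> \<and>
        C_class_on N (slice_base \<Omega>) \<alpha> \<and> C_class_on N (slice_base \<Omega>) \<beta> \<and>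
        (\<forall>I\<in>quat_sphere. \<forall>p\<in>slice_base \<Omega>.
           (1 / 2 ^ N) *\<^sub>R (cr_op I ^^ N) (\<lambda>p. \<alpha> p + I * \<beta> p) p = 0))"

end

theory Submission
  imports Defs "HOL-Complex_Analysis.Cauchy_Integral_Formula"
begin

text \<open>
  \<^bold>\<open>Idea of the proof.\<close>  Put \<open>e = (1 - J I) / 2\<close> and \<open>e' = (1 + J I) / 2\<close> for units \<open>I\<close> and \<open>J\<close>.
  The extension formula reads \<open>ext(h)(x + J y) = e h(x + I y) + e' h(x - I y)\<close>, and the two
  coefficients intertwine the complex structures: \<open>J e = e I\<close> and \<open>J e' = e' (- I)\<close>.  Thus left
  multiplication by \<open>e\<close> turns functions annihilated by \<open>\<partial>\<^sub>x + I \<partial>\<^sub>y\<close> into functions annihilated by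
  \<open>\<partial>\<^sub>x + J \<partial>\<^sub>y\<close>, and multiplication by \<open>e'\<close> does the same for \<open>\<partial>\<^sub>x - I \<partial>\<^sub>y\<close>, which annihilates the
  reflected function \<open>h(x - I y)\<close>.  So every \<open>ext(h\<^sub>k)\<close> is holomorphic on every slice
  (\<open>slice_ext_left_holomorphic\<close>).

  On the slice of \<open>J\<close>, the extension of \<open>f\<close> is therefore a sum of terms \<open>(x - J y)\<^sup>k g\<^sub>k\<close> with \<open>k < N\<close>
  and \<open>g\<^sub>k\<close> holomorphic.  The operator \<open>\<partial>\<^sub>x + J \<partial>\<^sub>y\<close> lowers the exponent by one and multiplies
  by \<open>2 k\<close>, so its \<open>N\<close>-th power is zero (\<open>cr_op_funpow_polyanalytic\<close>).

  By the same intertwining relations, \<open>e\<close> and \<open>e'\<close> carry powers of \<open>x - I y\<close> and \<open>x + I y\<close> to powers of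
  \<open>x - J y\<close>, so that the extension of \<open>f\<close> at \<open>x + J y\<close> is \<open>e f(x + I y) + e' f(x - I y)\<close>.  This is an
  affine function of \<open>J\<close> whose two coefficients are the components \<open>\<alpha>\<close> and \<open>\<beta>\<close>
  (\<open>poly_ext_slice_components\<close>).  They are of class \<open>C\<^sup>N\<close> because the
  \<open>h\<^sub>k\<close> are smooth: composing \<open>h\<^sub>k\<close> with suitable real linear maps to \<open>\<complex>\<close> gives ordinary
  holomorphic functions whose real parts are the coordinates of \<open>h\<^sub>k\<close>
  (\<open>left_holomorphic_on_imp_C_class_on\<close>).

  Uniqueness is the representation formula: \<open>\<alpha> + I \<beta>\<close> and \<open>\<alpha> - I \<beta>\<close> are the values of the function at
  \<open>x + I y\<close> and \<open>x - I y\<close>, and they determine \<open>\<alpha>\<close> and \<open>\<beta>\<close> (\<open>slice_components_determined\<close>).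
\<close>

section \<open>Functions of class \<open>C\<^sup>n\<close>\<close>

text \<open>
  The set must be open for the values on it to determine the derivatives at its points.
\<close>

lemma C_class_on_cong:
  assumes "open S" "\<And>x. x \<in> S \<Longrightarrow> g x = g' x" "C_class_on n S g"
  shows "C_class_on n S g'"
  using assms(2,3)
proof (induction n arbitrary: g g')
  case 0
  then show ?case by (auto cong: continuous_on_cong)
next
  case (Suc n)
  have der: "(g' has_derivative frechet_derivative g (at x)) (at x)" if "x \<in> S" for x
  proof (rule has_derivative_transform_within_open[OF _ \<open>open S\<close> that])
    show "(g has_derivative frechet_derivative g (at x)) (at x)"
      using Suc.prems that frechet_derivative_works by auto
  qed (use Suc.prems in auto)
  show ?case
    unfolding C_class_on.simps
  proof (intro conjI ballI allI)
    fix x assume "x \<in> S"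
    then show "g' differentiable (at x)"
      using der differentiable_def by blast
  next
    fix v
    show "C_class_on n S (\<lambda>x. frechet_derivative g' (at x) v)"
    proof (rule Suc.IH)
      show "C_class_on n S (\<lambda>x. frechet_derivative g (at x) v)"
        using Suc.prems by auto
      show "frechet_derivative g (at x) v = frechet_derivative g' (at x) v" if "x \<in> S" for x
        using frechet_derivative_at[OF der[OF that]] by simp
    qed
  qed
qed

lemma C_class_on_SucI:
  assumes "open S" "\<And>x. x \<in> S \<Longrightarrow> (g has_derivative g' x) (at x)"
    "\<And>v. C_class_on n S (\<lambda>x. g' x v)"
  shows "C_class_on (Suc n) S g"
  unfolding C_class_on.simps
proof (intro conjI ballI allI)
  fix x assume "x \<in> S"
  then show "g differentiable (at x)"
    using assms(2) differentiable_def by blast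
next
  fix v
  show "C_class_on n S (\<lambda>x. frechet_derivative g (at x) v)"
    by (rule C_class_on_cong[OF assms(1) _ assms(3)[of v]])
       (simp add: frechet_derivative_at[OF assms(2), symmetric])
qed

lemma C_class_on_has_derivative:
  assumes "C_class_on (Suc n) S g" "x \<in> S"
  shows "(g has_derivative frechet_derivative g (at x)) (at x)"
  using assms frechet_derivative_works by auto

lemma C_class_on_Suc_imp:
  "C_class_on (Suc n) S g \<Longrightarrow> C_class_on n S g"
proof (induction n arbitrary: g)
  case 0
  then show ?case
    by (auto intro!: continuous_at_imp_continuous_on differentiable_imp_continuous_within)
next
  case (Suc n)
  then show ?case by (metis C_class_on.simps(2))
qed

lemma C_class_on_const: "open S \<Longrightarrow> C_class_on n S (\<lambda>x. c)"
proof (induction n arbitrary: c)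
  case (Suc n)
  then show ?case
    by (intro C_class_on_SucI[where g' = "\<lambda>x v. 0"]) auto
qed simp

lemma C_class_on_bounded_linear:
  assumes "open S" "bounded_linear L"
  shows "C_class_on n S L"
proof (cases n)
  case 0
  then show ?thesis using assms by (simp add: linear_continuous_on)
next
  case (Suc m)
  then show ?thesis
    using C_class_on_SucI[OF assms(1) bounded_linear_imp_has_derivative[OF assms(2)]]
      C_class_on_const[OF assms(1)] by blast
qed

lemma C_class_on_bounded_linear_compose:
  assumes "open S" "bounded_linear L" "C_class_on n S g"
  shows "C_class_on n S (\<lambda>x. L (g x))"
  using assms(3)
proof (induction n arbitrary: g)
  case 0
  then show ?case
    using bounded_linear.continuous_on[OF assms(2)] by simp
next
  case (Suc n)
  show ?case
    by (rule C_class_on_SucI[OF assms(1)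
          bounded_linear.has_derivative[OF assms(2) C_class_on_has_derivative[OF Suc.prems]]])
       (use Suc in auto)
qed

lemma C_class_on_compose_bounded_linear:
  assumes "open S" "bounded_linear L" "L ` S \<subseteq> T" "C_class_on n T g"
  shows "C_class_on n S (\<lambda>x. g (L x))"
  using assms(4)
proof (induction n arbitrary: g)
  case 0
  then show ?case
    using continuous_on_compose2[of T g S L] linear_continuous_on[OF assms(2)] assms(3) by simp
next
  case (Suc n)
  show ?case
  proof (rule C_class_on_SucI[OF assms(1)])
    fix x assume "x \<in> S"
    then have "L x \<in> T" using assms(3) by auto
    then show "((\<lambda>x. g (L x)) has_derivative (\<lambda>v. frechet_derivative g (at (L x)) (L v))) (at x)"
      by (intro has_derivative_compose[OF bounded_linear_imp_has_derivative[OF assms(2)]]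
            C_class_on_has_derivative[OF Suc.prems])
  qed (use Suc in auto)
qed

lemma C_class_on_add:
  assumes "open S" "C_class_on n S f" "C_class_on n S g"
  shows "C_class_on n S (\<lambda>x. f x + g x)"
  using assms(2,3)
proof (induction n arbitrary: f g)
  case 0
  then show ?case by (auto intro: continuous_intros)
next
  case (Suc n)
  show ?case
    by (rule C_class_on_SucI[OF assms(1) has_derivative_add[OF
          C_class_on_has_derivative[OF Suc.prems(1)] C_class_on_has_derivative[OF Suc.prems(2)]]])
       (use Suc in auto)
qed

lemma C_class_on_diff:
  assumes "open S" "C_class_on n S f" "C_class_on n S g"
  shows "C_class_on n S (\<lambda>x. f x - g x)"
  using C_class_on_add[OF assms(1,2) C_class_on_bounded_linear_compose[OF assms(1) _ assms(3)],
      of uminus] bounded_linear_minus[OF bounded_linear_ident] by simp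

lemma C_class_on_sum:
  assumes "open S" "\<And>i. i \<in> A \<Longrightarrow> C_class_on n S (f i)"
  shows "C_class_on n S (\<lambda>x. \<Sum>i\<in>A. f i x)"
  using assms(2)
  by (induction A rule: infinite_finite_induct)
     (auto intro: C_class_on_const C_class_on_add assms(1))

lemma C_class_on_mult:
  fixes f g :: "'a::real_normed_vector \<Rightarrow> 'b::real_normed_algebra"
  assumes "open S" "C_class_on n S f" "C_class_on n S g"
  shows "C_class_on n S (\<lambda>x. f x * g x)"
  using assms(2,3)
proof (induction n arbitrary: f g)
  case 0
  then show ?case by (auto intro: continuous_intros)
next
  case (Suc n)
  show ?case
    by (rule C_class_on_SucI[OF assms(1) has_derivative_mult[OF
          C_class_on_has_derivative[OF Suc.prems(1)] C_class_on_has_derivative[OF Suc.prems(2)]]])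
       (use Suc.prems in \<open>auto intro!: C_class_on_add assms(1) Suc.IH
          C_class_on_Suc_imp[OF Suc.prems(1)] C_class_on_Suc_imp[OF Suc.prems(2)]\<close>)
qed

lemma C_class_on_power:
  fixes f :: "'a::real_normed_vector \<Rightarrow> 'b::real_normed_algebra_1"
  assumes "open S" "C_class_on n S f"
  shows "C_class_on n S (\<lambda>x. f x ^ k)"
  by (induction k) (auto intro: C_class_on_const C_class_on_mult assms)

lemma bounded_linear_Complex: "bounded_linear (\<lambda>p. Complex (fst p) (snd p))"
  unfolding Complex_eq
  by (intro bounded_linear_add bounded_linear_compose[OF bounded_linear_of_real]
        bounded_linear_compose[OF bounded_linear_mult_right] bounded_linear_fst bounded_linear_snd)

text \<open>
  Holomorphic functions are smooth in the sense of \<^const>\<open>C_class_on\<close>: a directional derivative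
  of \<open>F\<close> is \<open>F'\<close> times a constant, hence again holomorphic, and induction applies.
\<close>

lemma C_class_on_holomorphic:
  assumes "open T" "F holomorphic_on T" "open S" "\<And>p. p \<in> S \<Longrightarrow> Complex (fst p) (snd p) \<in> T"
  shows "C_class_on n S (\<lambda>p. F (Complex (fst p) (snd p)))"
  using assms(2)
proof (induction n arbitrary: F)
  case 0
  then show ?case
    using continuous_on_compose2[OF holomorphic_on_imp_continuous_on linear_continuous_on[OF bounded_linear_Complex],
        of F T S] assms(4) by (auto simp: image_subset_iff)
next
  case (Suc n)
  show ?case
  proof (rule C_class_on_SucI[OF assms(3)])
    fix p assume "p \<in> S"
    then have "(F has_field_derivative deriv F (Complex (fst p) (snd p))) (at (Complex (fst p) (snd p)))"
      using Suc.prems assms(1,4) holomorphic_derivI by blast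
    then show "((\<lambda>p. F (Complex (fst p) (snd p))) has_derivative
        (\<lambda>v. deriv F (Complex (fst p) (snd p)) * Complex (fst v) (snd v))) (at p)"
      unfolding has_field_derivative_def
      by (rule has_derivative_compose[OF bounded_linear_imp_has_derivative[OF bounded_linear_Complex]])
  next
    fix v :: "real \<times> real"
    show "C_class_on n S (\<lambda>p. deriv F (Complex (fst p) (snd p)) * Complex (fst v) (snd v))"
      by (intro Suc.IH[of "\<lambda>z. deriv F z * Complex (fst v) (snd v)"] holomorphic_on_mult
          holomorphic_deriv[OF Suc.prems assms(1)] holomorphic_on_const)
  qed
qed

section \<open>Quaternionic planes\<close>

text \<open>
  The parametrisation of a slice as a function of one variable in the plane, as needed for Frechet
  derivatives.  The conjugate point \<open>x - J y\<close> is written with the unit \<open>- J\<close>.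
\<close>

abbreviation slice_pt :: "quat \<Rightarrow> real \<times> real \<Rightarrow> quat" where
  "slice_pt J p \<equiv> slice_point J (fst p) (snd p)"

lemma quat_sphere_square: "J \<in> quat_sphere \<Longrightarrow> J * J = - 1"
  by (simp add: quat_sphere_def power2_eq_square)

lemma quat_sphere_square_left: "J \<in> quat_sphere \<Longrightarrow> J * (J * q) = - q"
  by (simp add: mult.assoc[symmetric] quat_sphere_square)

lemma quat_sphere_uminus: "J \<in> quat_sphere \<Longrightarrow> - J \<in> quat_sphere"
  by (simp add: quat_sphere_def)

lemma slice_point_uminus: "slice_point J x (- y) = slice_point (- J) x y"
  by (simp add: slice_point_def)

lemma slice_point_scaleR: "slice_point J x y = x *\<^sub>R 1 + y *\<^sub>R J"
  by (simp add: slice_point_def of_real_def)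

lemma qcnj_slice_point: "J \<in> quat_sphere \<Longrightarrow> qcnj (slice_point J x y) = slice_point (- J) x y"
  by (simp add: slice_point_def quat_eq_iff quat_sphere_iff)

lemma qRe_slice_point: "J \<in> quat_sphere \<Longrightarrow> qRe (slice_point J x y) = x"
  by (simp add: slice_point_def quat_sphere_iff)

lemma norm_qIm_slice_point:
  assumes "J \<in> quat_sphere"
  shows "norm (qIm (slice_point J x y)) = \<bar>y\<bar>"
proof -
  have "qIm (slice_point J x y) = y *\<^sub>R J"
    using assms by (simp add: slice_point_def qIm_def quat_eq_iff quat_sphere_iff)
  moreover have "norm J = 1"
    using assms by (simp add: quat_sphere_iff norm_quat_def)
  ultimately show ?thesis by simp
qed

lemma bounded_linear_slice_pt: "bounded_linear (slice_pt J)"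
  unfolding slice_point_def
  by (intro bounded_linear_add bounded_linear_compose[OF bounded_linear_of_real]
        bounded_linear_compose[OF bounded_linear_mult_right] bounded_linear_fst bounded_linear_snd)

lemma slice_pt_commute: "slice_pt J p * slice_pt J q = slice_pt J q * slice_pt J p"
  by (simp add: slice_point_scaleR algebra_simps)

section \<open>Left holomorphic functions\<close>

text \<open>
  Real differentiability together with the Cauchy--Riemann equation \<open>g\<^sub>x + J g\<^sub>y = 0\<close> says that the
  derivative is \<open>v \<mapsto> (v\<^sub>1 + J v\<^sub>2) d\<close> with \<open>d = g\<^sub>x\<close>.  This form makes the closure properties below
  calculations with a single derivative.
\<close>

definition left_holomorphic_on :: "quat \<Rightarrow> (real \<times> real) set \<Rightarrow> (real \<times> real \<Rightarrow> quat) \<Rightarrow> bool" where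
  "left_holomorphic_on J U g \<longleftrightarrow>
     (\<forall>p\<in>U. \<exists>d. (g has_derivative (\<lambda>v. slice_pt J v * d)) (at p))"

lemma partial_of_has_derivative:
  assumes "(g has_derivative L) (at p)"
  shows "partial_x g p = L (1, 0)" "partial_y g p = L (0, 1)"
proof -
  obtain x y where p: "p = (x, y)" by (cases p)
  interpret L: bounded_linear L using assms by (rule has_derivative_bounded_linear)
  have "((\<lambda>t. g (t, y)) has_derivative (\<lambda>t. L (t, 0))) (at x)"
    using assms p
    by (intro has_derivative_compose[where f = "\<lambda>t. (t, y)" and g = g])
       (auto intro!: derivative_eq_intros)
  moreover have "(\<lambda>t. L (t, 0)) = (\<lambda>t. t *\<^sub>R L (1, 0))"
    by (simp add: L.scaleR[symmetric])
  ultimately show "partial_x g p = L (1, 0)"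
    unfolding partial_x_def p by (simp add: has_vector_derivative_def vector_derivative_at)
  have "((\<lambda>t. g (x, t)) has_derivative (\<lambda>t. L (0, t))) (at y)"
    using assms p
    by (intro has_derivative_compose[where f = "\<lambda>t. (x, t)" and g = g])
       (auto intro!: derivative_eq_intros)
  moreover have "(\<lambda>t. L (0, t)) = (\<lambda>t. t *\<^sub>R L (0, 1))"
    by (simp add: L.scaleR[symmetric])
  ultimately show "partial_y g p = L (0, 1)"
    unfolding partial_y_def p by (simp add: has_vector_derivative_def vector_derivative_at)
qed

lemma cr_op_of_has_derivative:
  "(g has_derivative L) (at p) \<Longrightarrow> cr_op J g p = L (1, 0) + J * L (0, 1)"
  by (simp add: cr_op_def partial_of_has_derivative)

lemma left_holomorphic_on_slice:
  assumes J: "J \<in> quat_sphere" and h: "slice_holomorphic_on J D h"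
  shows "left_holomorphic_on J {p. slice_pt J p \<in> D} (\<lambda>p. h (slice_pt J p))"
  unfolding left_holomorphic_on_def
proof clarify
  fix x y assume xy: "slice_pt J (x, y) \<in> D"
  let ?g = "\<lambda>p. h (slice_pt J p)"
  have "(\<lambda>(x, y). h (slice_point J x y)) = ?g"
    by auto
  then have diff: "?g differentiable (at (x, y))" and cr: "cr_op J ?g (x, y) = 0"
    using h xy by (auto simp: slice_holomorphic_on_def Let_def)
  from diff obtain L where L: "(?g has_derivative L) (at (x, y))"
    unfolding differentiable_def by blast
  interpret L: bounded_linear L using L by (rule has_derivative_bounded_linear)
  have "L (1, 0) + J * L (0, 1) = 0"
    using cr cr_op_of_has_derivative[OF L] by simp
  then have "J * L (1, 0) + J * (J * L (0, 1)) = 0"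
    by (metis distrib_left mult_zero_right)
  then have L01: "L (0, 1) = J * L (1, 0)"
    by (simp add: quat_sphere_square_left[OF J])
  have "L v = slice_pt J v * L (1, 0)" for v
  proof -
    have "L v = fst v *\<^sub>R L (1, 0) + snd v *\<^sub>R L (0, 1)"
      by (simp add: L.scaleR[symmetric] L.add[symmetric])
    also have "\<dots> = slice_pt J v * L (1, 0)"
      unfolding L01 by (simp add: slice_point_scaleR distrib_right)
    finally show ?thesis .
  qed
  then have "L = (\<lambda>v. slice_pt J v * L (1, 0))"
    by (rule ext)
  with L show "\<exists>d. (?g has_derivative (\<lambda>v. slice_pt J v * d)) (at (x, y))"
    by metis
qed

lemma left_holomorphic_on_reflect:
  assumes "left_holomorphic_on J U g" "\<And>x y. (x, y) \<in> V \<Longrightarrow> (x, - y) \<in> U"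
  shows "left_holomorphic_on (- J) V (\<lambda>p. g (fst p, - snd p))"
  unfolding left_holomorphic_on_def
proof clarify
  fix x y assume "(x, y) \<in> V"
  then obtain d where d: "(g has_derivative (\<lambda>v. slice_pt J v * d)) (at (x, - y))"
    using assms unfolding left_holomorphic_on_def by blast
  have "((\<lambda>p. g (fst p, - snd p)) has_derivative (\<lambda>v. slice_pt J (fst v, - snd v) * d)) (at (x, y))"
    using d by (intro has_derivative_compose[where f = "\<lambda>p. (fst p, - snd p)" and g = g])
       (auto intro!: derivative_eq_intros)
  then show "\<exists>d. ((\<lambda>p. g (fst p, - snd p)) has_derivative (\<lambda>v. slice_pt (- J) v * d)) (at (x, y))"
    by (auto simp: slice_point_uminus)
qed

text \<open>
  If \<open>J e = e I\<close>, left multiplication by \<open>e\<close> is complex linear from the structure \<open>I\<close> to the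
  structure \<open>J\<close>, so it maps functions holomorphic for \<open>I\<close> to functions holomorphic for \<open>J\<close>.
\<close>

lemma left_holomorphic_on_intertwine:
  assumes "left_holomorphic_on I U g" "J * e = e * I"
  shows "left_holomorphic_on J U (\<lambda>p. e * g p)"
  unfolding left_holomorphic_on_def
proof
  fix p assume "p \<in> U"
  then obtain d where d: "(g has_derivative (\<lambda>v. slice_pt I v * d)) (at p)"
    using assms unfolding left_holomorphic_on_def by blast
  have "e * slice_pt I v = slice_pt J v * e" for v
    using assms(2) by (simp add: slice_point_scaleR algebra_simps)
  then have "e * (slice_pt I v * d) = slice_pt J v * (e * d)" for v
    by (simp add: mult.assoc[symmetric])
  with has_derivative_mult_right[OF d, of e]
  show "\<exists>d. ((\<lambda>p. e * g p) has_derivative (\<lambda>v. slice_pt J v * d)) (at p)"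
    by auto
qed

lemma left_holomorphic_on_add:
  assumes "left_holomorphic_on J U g" "left_holomorphic_on J U g'"
  shows "left_holomorphic_on J U (\<lambda>p. g p + g' p)"
  unfolding left_holomorphic_on_def
proof
  fix p assume "p \<in> U"
  then obtain d d' where "(g has_derivative (\<lambda>v. slice_pt J v * d)) (at p)"
    "(g' has_derivative (\<lambda>v. slice_pt J v * d')) (at p)"
    using assms unfolding left_holomorphic_on_def by blast
  from has_derivative_add[OF this]
  show "\<exists>d. ((\<lambda>p. g p + g' p) has_derivative (\<lambda>v. slice_pt J v * d)) (at p)"
    unfolding distrib_left[symmetric] by blast
qed

text \<open>
  Smoothness is inherited from the complex case.  For each quaternion \<open>c\<close>, the real linear map
  \<open>\<phi>\<^sub>c(q) = \<langle>c, q\<rangle> - i \<langle>c, J q\<rangle>\<close> satisfies \<open>\<phi>\<^sub>c(J q) = i \<phi>\<^sub>c(q)\<close>.  Hence \<open>\<phi>\<^sub>c\<close> composed with \<open>g\<close> is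
  holomorphic in the ordinary sense, and its real part \<open>\<langle>c, g\<rangle>\<close> is smooth.  Letting \<open>c\<close> run
  through the standard basis recovers \<open>g\<close>.
\<close>

lemma left_holomorphic_on_imp_C_class_on:
  assumes J: "J \<in> quat_sphere" and U: "open U" and g: "left_holomorphic_on J U g"
  shows "C_class_on n U g"
proof -
  define \<phi> where "\<phi> c q = Complex (inner c q) (- inner c (J * q))" for c q
  have phi_lin: "bounded_linear (\<phi> c)" for c
    unfolding \<phi>_def Complex_eq
    by (intro bounded_linear_add bounded_linear_compose[OF bounded_linear_of_real]
          bounded_linear_compose[OF bounded_linear_mult_right] bounded_linear_minus
          bounded_linear_inner_right
          bounded_linear_compose[OF bounded_linear_inner_right] bounded_linear_mult_right)
  have phi_J: "\<phi> c (slice_pt J v * d) = \<phi> c d * Complex (fst v) (snd v)" for c v d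
    using quat_sphere_square_left[OF J]
    by (simp add: \<phi>_def complex_eq_iff slice_point_scaleR inner_diff_right algebra_simps)
  define T where "T = {z. (Re z, Im z) \<in> U}"
  have lin: "bounded_linear (\<lambda>z. (Re z, Im z))"
    by (intro bounded_linear_Pair bounded_linear_Re bounded_linear_Im)
  have "open ((\<lambda>z. (Re z, Im z)) -` U)"
    by (intro open_vimage U linear_continuous_on lin)
  then have T: "open T" by (simp add: T_def vimage_def)
  have smooth: "C_class_on n U (\<lambda>p. inner c (g p))" for c
  proof -
    let ?F = "\<lambda>z. \<phi> c (g (Re z, Im z))"
    have "?F holomorphic_on T"
      unfolding holomorphic_on_open[OF T]
    proof
      fix z assume "z \<in> T"
      then obtain d where d: "(g has_derivative (\<lambda>v. slice_pt J v * d)) (at (Re z, Im z))"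
        using g unfolding left_holomorphic_on_def T_def by blast
      have "(?F has_derivative (\<lambda>w. \<phi> c (slice_pt J (Re w, Im w) * d))) (at z)"
        by (intro bounded_linear.has_derivative[OF phi_lin]
              has_derivative_compose[OF bounded_linear_imp_has_derivative[OF lin] d])
      then have "(?F has_derivative (*) (\<phi> c d)) (at z)"
        using phi_J[of c "(Re _, Im _)" d] by simp
      then show "\<exists>f'. (?F has_field_derivative f') (at z)"
        unfolding has_field_derivative_def by blast
    qed
    then have "C_class_on n U (\<lambda>p. ?F (Complex (fst p) (snd p)))"
      by (rule C_class_on_holomorphic[OF T _ U]) (simp add: T_def)
    from C_class_on_bounded_linear_compose[OF U bounded_linear_Re this] show ?thesis
      by (simp add: \<phi>_def)
  qed
  let ?B = "{Quat 1 0 0 0, Quat 0 1 0 0, Quat 0 0 1 0, Quat 0 0 0 1}"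
  have "C_class_on n U (\<lambda>p. \<Sum>c\<in>?B. inner c (g p) *\<^sub>R c)"
    by (intro C_class_on_sum U
        C_class_on_bounded_linear_compose[OF U bounded_linear_scaleR_left] smooth)
  moreover have "(\<Sum>c\<in>?B. inner c q *\<^sub>R c) = q" for q
    by (simp add: quat_eq_iff inner_quat_def)
  ultimately show ?thesis by simp
qed

section \<open>Polyanalyticity\<close>

text \<open>
  The power rule takes its commutative form, since all values and derivatives of the map lie in
  the commutative plane of \<open>J\<close>.
\<close>

lemma has_derivative_slice_pt_power:
  "((\<lambda>p. slice_pt J p ^ k) has_derivative
     (\<lambda>v. real k *\<^sub>R (slice_pt J p ^ (k - 1) * slice_pt J v))) (at p)"
proof (induction k)
  case (Suc k)
  have "slice_pt J v * slice_pt J p ^ k = slice_pt J p ^ k * slice_pt J v" for v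
    by (rule power_commuting_commutes[OF slice_pt_commute, symmetric])
  moreover have "slice_pt J p * (real k *\<^sub>R (slice_pt J p ^ (k - 1) * slice_pt J v))
        = real k *\<^sub>R (slice_pt J p ^ k * slice_pt J v)" for v
    by (cases k) (simp_all add: mult.assoc)
  ultimately have "slice_pt J p * (real k *\<^sub>R (slice_pt J p ^ (k - 1) * slice_pt J v))
        + slice_pt J v * slice_pt J p ^ k
      = real (Suc k) *\<^sub>R (slice_pt J p ^ (Suc k - 1) * slice_pt J v)" for v
    by (simp add: scaleR_left_distrib)
  with has_derivative_mult[OF bounded_linear_imp_has_derivative[OF bounded_linear_slice_pt] Suc, of J]
  show ?case by (simp del: of_nat_Suc)
qed simp

text \<open>
  Here \<open>J\<close> commutes with \<open>w = x - J y\<close>, so in \<open>(\<partial>\<^sub>x + J \<partial>\<^sub>y) (w\<^sup>k g)\<close> the terms in which \<open>g\<close> is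
  differentiated cancel, while \<open>(\<partial>\<^sub>x + J \<partial>\<^sub>y) w = 2\<close>.  For \<open>k = 0\<close> the truncated exponent is harmless
  because of the factor \<open>k\<close>.  The derivative itself is part of the conclusion: Cauchy--Riemann
  operators of sums are computed from it.
\<close>

lemma cr_op_polyanalytic_term:
  assumes J: "J \<in> quat_sphere" and "left_holomorphic_on J U g" "p \<in> U"
  shows "\<exists>L. ((\<lambda>p. slice_pt (- J) p ^ k * g p) has_derivative L) (at p) \<and>
    L (1, 0) + J * L (0, 1) = slice_pt (- J) p ^ (k - 1) * ((2 * real k) *\<^sub>R g p)"
proof -
  let ?w = "slice_pt (- J) p"
  obtain d where d: "(g has_derivative (\<lambda>v. slice_pt J v * d)) (at p)"
    using assms unfolding left_holomorphic_on_def by blast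
  have "?w * J = J * ?w"
    by (simp add: slice_point_scaleR algebra_simps)
  then have J_w: "J * ?w ^ m = ?w ^ m * J" for m
    by (rule power_commuting_commutes[symmetric])
  have "(J * ?w ^ m) * (J * q) = - (?w ^ m * q)" for m q
    unfolding J_w by (simp add: mult.assoc quat_sphere_square_left[OF J])
  then have J_J: "J * (?w ^ m * (J * q)) = - (?w ^ m * q)" for m q
    by (simp add: mult.assoc)
  have twice: "(2 * real k) *\<^sub>R q = real k *\<^sub>R q + real k *\<^sub>R q" for q :: quat
    by (simp flip: scaleR_left_distrib)
  show ?thesis
  proof (intro exI conjI)
    show "((\<lambda>p. slice_pt (- J) p ^ k * g p) has_derivative
       (\<lambda>v. ?w ^ k * (slice_pt J v * d) + real k *\<^sub>R (?w ^ (k - 1) * slice_pt (- J) v) * g p)) (at p)"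
      by (rule has_derivative_mult[OF has_derivative_slice_pt_power d])
    show "?w ^ k * (slice_pt J (1, 0) * d) + real k *\<^sub>R (?w ^ (k - 1) * slice_pt (- J) (1, 0)) * g p +
       J * (?w ^ k * (slice_pt J (0, 1) * d) + real k *\<^sub>R (?w ^ (k - 1) * slice_pt (- J) (0, 1)) * g p)
      = ?w ^ (k - 1) * ((2 * real k) *\<^sub>R g p)"
      by (simp add: slice_point_scaleR[of _ 0 1] slice_point_scaleR[of _ 1 0] distrib_left mult.assoc
          right_diff_distrib J_J twice)
  qed
qed

lemma left_holomorphic_on_scaleR:
  assumes "left_holomorphic_on J U g"
  shows "left_holomorphic_on J U (\<lambda>p. c *\<^sub>R g p)"
  using left_holomorphic_on_intertwine[OF assms, of J "c *\<^sub>R 1"] by simp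

text \<open>
  Applying \<open>\<partial>\<^sub>x + J \<partial>\<^sub>y\<close> to a polynomial of degree less than \<open>n + 1\<close> in \<open>x - J y\<close> with holomorphic
  coefficients gives such a polynomial of degree less than \<open>n\<close>, with coefficients
  \<open>2 (k + 1) g\<^sub>k\<^sub>+\<^sub>1\<close>.
\<close>

lemma cr_op_funpow_polyanalytic:
  assumes J: "J \<in> quat_sphere" and U: "open U"
    and g: "\<And>k. k < n \<Longrightarrow> left_holomorphic_on J U (g k)"
    and F: "\<And>p. p \<in> U \<Longrightarrow> F p = (\<Sum>k<n. slice_pt (- J) p ^ k * g k p)"
    and p: "p \<in> U"
  shows "(cr_op J ^^ n) F p = 0"
  using g F
proof (induction n arbitrary: g F)
  case 0
  then show ?case using p by simp
next
  case (Suc n)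
  have "cr_op J F q = (\<Sum>k<n. slice_pt (- J) q ^ k * ((2 * real (Suc k)) *\<^sub>R g (Suc k) q))"
    if q: "q \<in> U" for q
  proof -
    have "\<forall>k. \<exists>L. k < Suc n \<longrightarrow> ((\<lambda>p. slice_pt (- J) p ^ k * g k p) has_derivative L) (at q) \<and>
      L (1, 0) + J * L (0, 1) = slice_pt (- J) q ^ (k - 1) * ((2 * real k) *\<^sub>R g k q)"
      using cr_op_polyanalytic_term[OF J Suc.prems(1) q] by blast
    from choice[OF this] obtain L where
      L: "\<forall>k. k < Suc n \<longrightarrow> ((\<lambda>p. slice_pt (- J) p ^ k * g k p) has_derivative L k) (at q) \<and>
        L k (1, 0) + J * L k (0, 1) = slice_pt (- J) q ^ (k - 1) * ((2 * real k) *\<^sub>R g k q)" ..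
    have "((\<lambda>p. \<Sum>k<Suc n. slice_pt (- J) p ^ k * g k p) has_derivative (\<lambda>v. \<Sum>k<Suc n. L k v)) (at q)"
      by (rule has_derivative_sum) (use L in auto)
    then have "(F has_derivative (\<lambda>v. \<Sum>k<Suc n. L k v)) (at q)"
      by (rule has_derivative_transform_within_open[OF _ U q]) (simp add: Suc.prems(2))
    then have "cr_op J F q = (\<Sum>k<Suc n. L k (1, 0) + J * L k (0, 1))"
      by (simp only: cr_op_of_has_derivative sum.distrib sum_distrib_left)
    also have "\<dots> = (\<Sum>k<Suc n. slice_pt (- J) q ^ (k - 1) * ((2 * real k) *\<^sub>R g k q))"
      by (rule sum.cong) (simp_all add: L)
    also have "\<dots> = (\<Sum>k<n. slice_pt (- J) q ^ k * ((2 * real (Suc k)) *\<^sub>R g (Suc k) q))"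
      by (simp only: sum.lessThan_Suc_shift) simp
    finally show ?thesis .
  qed
  then have "(cr_op J ^^ n) (cr_op J F) p = 0"
    by (intro Suc.IH[where g = "\<lambda>k p. (2 * real (Suc k)) *\<^sub>R g (Suc k) p"])
       (auto intro!: left_holomorphic_on_scaleR Suc.prems(1))
  then show ?case by (simp only: funpow_Suc_right comp_def)
qed

section \<open>Slice functions\<close>

lemma slice_ext_two_point:
  assumes J: "J \<in> quat_sphere"
  shows "slice_ext I h (slice_point J x y) =
    ((1 / 2) *\<^sub>R (1 - J * I)) * h (slice_point I x y) +
    ((1 / 2) *\<^sub>R (1 + J * I)) * h (slice_point I x (- y))"
  unfolding slice_ext_slice_point[OF J]
  by (simp add: left_diff_distrib right_diff_distrib distrib_right distrib_left
      scaleR_diff_right scaleR_add_right)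

text \<open>
  Both relations express that \<open>J (1 - J I) = J + I = (1 - J I) I\<close> and
  \<open>J (1 + J I) = J - I = (1 + J I) (- I)\<close>.
\<close>

lemma two_point_coefficients_intertwine:
  assumes I: "I \<in> quat_sphere" and J: "J \<in> quat_sphere"
  shows "J * ((1 / 2) *\<^sub>R (1 - J * I)) = ((1 / 2) *\<^sub>R (1 - J * I)) * I"
    and "J * ((1 / 2) *\<^sub>R (1 + J * I)) = ((1 / 2) *\<^sub>R (1 + J * I)) * (- I)"
proof -
  have "(J * I) * I = - J" by (simp add: mult.assoc quat_sphere_square[OF I])
  then show "J * ((1 / 2) *\<^sub>R (1 - J * I)) = ((1 / 2) *\<^sub>R (1 - J * I)) * I"
    and "J * ((1 / 2) *\<^sub>R (1 + J * I)) = ((1 / 2) *\<^sub>R (1 + J * I)) * (- I)"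
    by (simp_all add: right_diff_distrib left_diff_distrib distrib_left distrib_right
        quat_sphere_square_left[OF J] scaleR_diff_right)
qed

lemma slice_pt_power_intertwine:
  assumes "J * e = e * I"
  shows "slice_pt J p ^ k * e = e * slice_pt I p ^ k"
proof (induction k)
  case (Suc k)
  have "slice_pt J p * e = e * slice_pt I p"
    using assms by (simp add: slice_point_scaleR algebra_simps)
  then show ?case using Suc by (metis mult.assoc power_Suc)
qed simp

text \<open>
  The representation formula in the form of a uniqueness statement: a slice function is known
  once it is known on a single slice, because the values at \<open>x + I y\<close> and \<open>x - I y\<close> give
  \<open>\<alpha> + I \<beta>\<close> and \<open>\<alpha> - I \<beta>\<close>, from which \<open>\<alpha>\<close> and \<open>\<beta>\<close> can be recovered.
\<close>

lemma slice_components_determined: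
  assumes "I \<in> quat_sphere" "axially_symmetric \<Omega>" "\<Omega> \<subseteq> {slice_point J x y | J x y. J \<in> quat_sphere}"
    and f: "slice_components \<Omega> f \<alpha> \<beta>" and g: "slice_components \<Omega> g \<alpha>' \<beta>'"
    and eq: "\<And>z. z \<in> \<Omega> \<Longrightarrow> z \<in> slice_plane I \<Longrightarrow> f z = g z"
    and q: "q \<in> \<Omega>"
  shows "f q = g q"
proof -
  obtain J x y where J: "J \<in> quat_sphere" and qJ: "q = slice_point J x y"
    using q assms(3) by blast
  have mI: "- I \<in> quat_sphere" by (rule quat_sphere_uminus[OF assms(1)])
  have zI: "slice_point I x y \<in> \<Omega>" "slice_point (- I) x y \<in> \<Omega>"
    using assms(1,2) mI J q unfolding axially_symmetric_def qJ by blast+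
  have "slice_point I x y \<in> slice_plane I" "slice_point (- I) x y \<in> slice_plane I"
    unfolding slice_plane_def slice_point_uminus[symmetric] by blast+
  then have "f (slice_point I x y) = g (slice_point I x y)"
    "f (slice_point (- I) x y) = g (slice_point (- I) x y)"
    using eq zI by blast+
  then have *: "\<alpha> (x, y) + I * \<beta> (x, y) = \<alpha>' (x, y) + I * \<beta>' (x, y)"
    "\<alpha> (x, y) - I * \<beta> (x, y) = \<alpha>' (x, y) - I * \<beta>' (x, y)"
    using f g zI mI assms(1) by (auto simp: slice_components_def)
  have "2 *\<^sub>R \<alpha> (x, y) = 2 *\<^sub>R \<alpha>' (x, y)"
    using arg_cong2[OF *, of "(+)"] by (simp add: scaleR_2)
  then have a: "\<alpha> (x, y) = \<alpha>' (x, y)" by simp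
  with *(1) have "I * (I * \<beta> (x, y)) = I * (I * \<beta>' (x, y))" by simp
  then have "\<beta> (x, y) = \<beta>' (x, y)" by (simp add: quat_sphere_square_left[OF assms(1)])
  with a show ?thesis
    using f g q J unfolding qJ by (auto simp: slice_components_def)
qed

section \<open>The axially symmetric completion\<close>

text \<open>
  A point determines its parameters \<open>(x, y)\<close> only up to the sign of \<open>y\<close>; the symmetry of \<open>D\<close>
  removes this ambiguity.
\<close>

lemma mem_axial_completion_iff:
  assumes I: "I \<in> quat_sphere" and sym: "\<forall>z\<in>D. qcnj z \<in> D" and J: "J \<in> quat_sphere"
  shows "slice_point J x y \<in> axial_completion I D \<longleftrightarrow> slice_point I x y \<in> D"
proof
  assume "slice_point J x y \<in> axial_completion I D"
  then obtain J' x' y' where J': "J' \<in> quat_sphere" and eq: "slice_point J x y = slice_point J' x' y'"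
    and D: "slice_point I x' y' \<in> D"
    unfolding axial_completion_def by blast
  have "x = x'" "\<bar>y\<bar> = \<bar>y'\<bar>"
    using arg_cong[OF eq, of qRe] arg_cong[OF eq, of "\<lambda>q. norm (qIm q)"] J J'
    by (simp_all add: qRe_slice_point norm_qIm_slice_point)
  moreover have "slice_point I x' (- y') \<in> D"
    using sym D by (metis qcnj_slice_point[OF I] slice_point_uminus)
  ultimately show "slice_point I x y \<in> D"
    using D by (auto simp: abs_eq_iff)
next
  assume "slice_point I x y \<in> D"
  then show "slice_point J x y \<in> axial_completion I D"
    unfolding axial_completion_def using J by blast
qed

text \<open>
  Written as a preimage under a continuous map, the completion is seen to be open.
\<close>

lemma axial_completion_eq_vimage:
  assumes "I \<in> quat_sphere" "\<forall>z\<in>D. qcnj z \<in> D"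
  shows "axial_completion I D = (\<lambda>q. (qRe q, norm (qIm q))) -` {p. slice_pt I p \<in> D}"
proof -
  have "q \<in> axial_completion I D \<longleftrightarrow> slice_point I (qRe q) (norm (qIm q)) \<in> D" for q
    using mem_axial_completion_iff[OF assms im_unit_in_sphere, of q] slice_point_im_unit[of q]
    by metis
  then show ?thesis by auto
qed

lemma open_slice_parameters:
  assumes "openin (top_of_set (slice_plane I)) D"
  shows "open {p. slice_pt I p \<in> D}"
proof -
  obtain T where T: "open T" "D = slice_plane I \<inter> T"
    using assms by (auto simp: openin_open)
  have "{p. slice_pt I p \<in> D} = slice_pt I -` T"
    by (auto simp: T(2) slice_plane_def)
  then show ?thesis
    using open_vimage[OF T(1) linear_continuous_on[OF bounded_linear_slice_pt]] by simp
qed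

lemma continuous_on_qRe_norm_qIm: "continuous_on A (\<lambda>q. (qRe q, norm (qIm q)))"
proof -
  have "continuous_on A (\<lambda>q. inner 1 q :: real)"
    by (intro continuous_intros)
  then have re: "continuous_on A qRe" by (simp add: inner_quat_def)
  have "q - of_real (qRe q) = qIm q" for q
    by (simp add: quat_eq_iff qIm_def)
  moreover have "continuous_on A (\<lambda>q. q - of_real (qRe q))"
    by (intro continuous_intros re)
  ultimately have "continuous_on A qIm" by simp
  with re show ?thesis by (intro continuous_on_Pair continuous_on_norm)
qed

section \<open>The extension theorem\<close>

lemma slice_ext_same_plane:
  "I \<in> quat_sphere \<Longrightarrow> slice_ext I h (slice_point I x y) = h (slice_point I x y)"
  by (simp add: slice_ext_two_point quat_sphere_square scaleR_2[symmetric])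

text \<open>
  By intertwining, \<open>(x - J y)\<^sup>k e = e (x - I y)\<^sup>k\<close> and \<open>(x - J y)\<^sup>k e' = e' (x + I y)\<^sup>k\<close>.  So the powers of
  the conjugate variable can be moved inside, and the whole sum has the same shape
  \<open>e u(x, y) + e' u(x, - y)\<close> as the extension of a single function.  Sorting by \<open>J\<close> gives the
  components, whose parity in \<open>y\<close> is visible.
\<close>

lemma poly_ext_slice_components:
  fixes N h I
  defines "u \<equiv> \<lambda>p. \<Sum>k<N. slice_pt (- I) p ^ k * h k (slice_pt I p)"
  assumes I: "I \<in> quat_sphere"
  shows "slice_components \<Omega> (poly_ext N I h)
    (\<lambda>p. (1 / 2) *\<^sub>R (u p + u (fst p, - snd p)))
    (\<lambda>p. (1 / 2) *\<^sub>R (I * (u (fst p, - snd p) - u p)))"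
proof -
  have "poly_ext N I h (slice_point J x y) =
     (1 / 2) *\<^sub>R (u (x, y) + u (x, - y)) + J * ((1 / 2) *\<^sub>R (I * (u (x, - y) - u (x, y))))"
    if J: "J \<in> quat_sphere" for J x y
  proof -
    let ?e = "(1 / 2) *\<^sub>R (1 - J * I)" and ?e' = "(1 / 2) *\<^sub>R (1 + J * I)"
    note pow = slice_pt_power_intertwine[of "- J" _ _ "(x, y)", simplified]
    have e: "slice_point (- J) x y ^ k * ?e = ?e * slice_point (- I) x y ^ k" for k
      by (rule pow) (use two_point_coefficients_intertwine(1)[OF I J] in simp)
    have e': "slice_point (- J) x y ^ k * ?e' = ?e' * slice_point I x y ^ k" for k
      by (rule pow) (use two_point_coefficients_intertwine(2)[OF I J] in simp)
    have "qcnj (slice_point J x y) ^ k * slice_ext I (h k) (slice_point J x y) =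
        ?e * (slice_point (- I) x y ^ k * h k (slice_point I x y)) +
        ?e' * (slice_point I x y ^ k * h k (slice_point (- I) x y))" for k
      unfolding slice_ext_two_point[OF J] qcnj_slice_point[OF J] distrib_left
        mult.assoc[symmetric] e e' slice_point_uminus ..
    then have "poly_ext N I h (slice_point J x y) = ?e * u (x, y) + ?e' * u (x, - y)"
      by (simp add: poly_ext_def u_def sum.distrib sum_distrib_left slice_point_uminus)
    then show ?thesis
      by (simp add: left_diff_distrib right_diff_distrib distrib_right distrib_left
          scaleR_diff_right scaleR_add_right mult.assoc)
  qed
  then show ?thesis
    by (auto simp: slice_components_def add.commute right_diff_distrib scaleR_diff_right)
qed

lemma slice_ext_left_holomorphic:
  assumes I: "I \<in> quat_sphere" and J: "J \<in> quat_sphere" and sym: "\<forall>z\<in>D. qcnj z \<in> D"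
    and h: "slice_holomorphic_on I D h"
  shows "left_holomorphic_on J {p. slice_pt I p \<in> D} (\<lambda>p. slice_ext I h (slice_pt J p))"
proof -
  let ?U = "{p. slice_pt I p \<in> D}"
  have hol: "left_holomorphic_on I ?U (\<lambda>p. h (slice_pt I p))"
    by (rule left_holomorphic_on_slice[OF I h])
  have "left_holomorphic_on (- I) ?U (\<lambda>p. h (slice_pt I (fst p, - snd p)))"
    by (rule left_holomorphic_on_reflect[OF hol])
       (use sym in \<open>auto simp: slice_point_uminus simp flip: qcnj_slice_point[OF I]\<close>)
  then have "left_holomorphic_on J ?U (\<lambda>p.
      ((1 / 2) *\<^sub>R (1 - J * I)) * h (slice_pt I p) +
      ((1 / 2) *\<^sub>R (1 + J * I)) * h (slice_pt I (fst p, - snd p)))"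
    by (intro left_holomorphic_on_add
        left_holomorphic_on_intertwine[OF hol two_point_coefficients_intertwine(1)[OF I J]]
        left_holomorphic_on_intertwine[OF _ two_point_coefficients_intertwine(2)[OF I J]])
  then show ?thesis by (simp add: slice_ext_two_point[OF J])
qed

lemma poly_ext_slice_polyanalytic:
  assumes I: "I \<in> quat_sphere" and op: "openin (top_of_set (slice_plane I)) D"
    and sym: "\<forall>z\<in>D. qcnj z \<in> D" and h: "\<forall>k<N. slice_holomorphic_on I D (h k)"
  shows "slice_polyanalytic_on N (axial_completion I D) (poly_ext N I h)"
proof -
  let ?U = "{p. slice_pt I p \<in> D}" and ?\<Omega> = "axial_completion I D"
  define u where "u p = (\<Sum>k<N. slice_pt (- I) p ^ k * h k (slice_pt I p))" for p
  define \<alpha> where "\<alpha> p = (1 / 2) *\<^sub>R (u p + u (fst p, - snd p))" for p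
  define \<beta> where "\<beta> p = (1 / 2) *\<^sub>R (I * (u (fst p, - snd p) - u p))" for p
  note mem = mem_axial_completion_iff[OF I sym]
  have U: "open ?U" by (rule open_slice_parameters[OF op])
  have open_\<Omega>: "open ?\<Omega>"
    unfolding axial_completion_eq_vimage[OF I sym]
    by (rule open_vimage[OF U continuous_on_qRe_norm_qIm])
  have base: "slice_base ?\<Omega> = ?U"
    using mem I by (auto simp: slice_base_def)
  have comp: "slice_components ?\<Omega> (poly_ext N I h) \<alpha> \<beta>"
    using poly_ext_slice_components[OF I, of ?\<Omega> N h]
    unfolding \<alpha>_def[abs_def] \<beta>_def[abs_def] u_def[abs_def] .
  have u: "C_class_on N ?U u"
    unfolding u_def[abs_def]
    by (intro C_class_on_sum C_class_on_mult C_class_on_power U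
        C_class_on_bounded_linear[OF U bounded_linear_slice_pt]
        left_holomorphic_on_imp_C_class_on[OF I] left_holomorphic_on_slice[OF I])
       (use h in auto)
  have refl: "C_class_on N ?U (\<lambda>p. u (fst p, - snd p))"
    by (rule C_class_on_compose_bounded_linear[OF U _ _ u])
       (use sym in \<open>auto simp: slice_point_uminus simp flip: qcnj_slice_point[OF I]
          intro!: bounded_linear_Pair bounded_linear_fst bounded_linear_minus bounded_linear_snd\<close>)
  have "C_class_on N ?U \<alpha>" "C_class_on N ?U \<beta>"
    unfolding \<alpha>_def[abs_def] \<beta>_def[abs_def]
    by (intro C_class_on_bounded_linear_compose[OF U bounded_linear_scaleR_right]
        C_class_on_bounded_linear_compose[OF U bounded_linear_mult_right]
        C_class_on_add C_class_on_diff U u refl)+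
  moreover have "(cr_op J ^^ N) (\<lambda>p. \<alpha> p + J * \<beta> p) p = 0"
    if J: "J \<in> quat_sphere" and p: "p \<in> ?U" for J p
  proof (rule cr_op_funpow_polyanalytic[OF J U _ _ p])
    fix k assume "k < N"
    then show "left_holomorphic_on J ?U (\<lambda>p. slice_ext I (h k) (slice_pt J p))"
      using h by (intro slice_ext_left_holomorphic[OF I J sym]) auto
  next
    fix q assume "q \<in> ?U"
    then have "slice_pt J q \<in> ?\<Omega>" by (simp add: mem[OF J])
    then have "poly_ext N I h (slice_pt J q) = \<alpha> q + J * \<beta> q"
      using comp J by (auto simp: slice_components_def)
    then show "\<alpha> q + J * \<beta> q = (\<Sum>k<N. slice_pt (- J) q ^ k * slice_ext I (h k) (slice_pt J q))"
      by (simp add: poly_ext_def qcnj_slice_point[OF J])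
  qed
  moreover have "axially_symmetric ?\<Omega>"
    using mem by (auto simp: axially_symmetric_def)
  ultimately show ?thesis
    unfolding slice_polyanalytic_on_def base using open_\<Omega> comp
    by (intro conjI exI[of _ \<alpha>] exI[of _ \<beta>]) simp_all
qed

theorem proposition3p13:
  fixes N :: nat and I :: quat and D :: "quat set"
    and h :: "nat \<Rightarrow> quat \<Rightarrow> quat" and f :: "quat \<Rightarrow> quat"
  assumes "N \<ge> 1"
    and "I \<in> quat_sphere"
    and "openin (top_of_set (slice_plane I)) D"
    and "connected D"
    and "\<forall>z\<in>D. qcnj z \<in> D"
    and "D \<inter> \<real> \<noteq> {}"
    and "\<forall>k<N. slice_holomorphic_on I D (h k)"
    and "\<forall>k<N. \<forall>z\<in>D. qcnj (h k (qcnj z)) = h k z"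
    and "\<forall>z\<in>D. f z = (\<Sum>k<N. qcnj z ^ k * h k z)"
  shows "slice_polyanalytic_on N (axial_completion I D) (poly_ext N I h) \<and>
    (\<forall>z\<in>D. poly_ext N I h z = f z) \<and>
    (\<forall>g. slice_polyanalytic_on N (axial_completion I D) g \<and> (\<forall>z\<in>D. g z = f z) \<longrightarrow>
       (\<forall>q\<in>axial_completion I D. g q = poly_ext N I h q))"
proof -
  let ?\<Omega> = "axial_completion I D"
  note I = assms(2)
  have ext: "slice_polyanalytic_on N ?\<Omega> (poly_ext N I h)"
    using assms by (intro poly_ext_slice_polyanalytic) auto
  have mem_D: "\<exists>x y. z = slice_point I x y" if "z \<in> D" for z
    using openin_imp_subset[OF assms(3)] that by (auto simp: slice_plane_def)
  have eq: "poly_ext N I h z = f z" if "z \<in> D" for z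
    using mem_D[OF that] assms(9) that by (auto simp: poly_ext_def slice_ext_same_plane[OF I])
  have "g q = poly_ext N I h q"
    if g: "slice_polyanalytic_on N ?\<Omega> g" "\<forall>z\<in>D. g z = f z" and q: "q \<in> ?\<Omega>" for g q
  proof -
    obtain \<alpha> \<beta> \<alpha>' \<beta>' where "slice_components ?\<Omega> g \<alpha> \<beta>"
      "slice_components ?\<Omega> (poly_ext N I h) \<alpha>' \<beta>'"
      using g ext unfolding slice_polyanalytic_on_def by blast
    then show ?thesis
    proof (rule slice_components_determined[OF I _ _ _ _ _ q, rotated 2])
      show "axially_symmetric ?\<Omega>" using g by (simp add: slice_polyanalytic_on_def)
      show "?\<Omega> \<subseteq> {slice_point J x y | J x y. J \<in> quat_sphere}"
        unfolding axial_completion_def by blast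
      fix z assume "z \<in> ?\<Omega>" "z \<in> slice_plane I"
      then have "z \<in> D"
        using mem_axial_completion_iff[OF I assms(5) I] by (auto simp: slice_plane_def)
      then show "g z = poly_ext N I h z" using g eq by simp
    qed
  qed
  with ext eq show ?thesis by blast
qed

end
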